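(* Let $n \geq 7$ be an integer and let $A_3 = \begin{bmatrix} 1 & 2 \\ 2 & 1 \end{bmatrix}$. If $n$ is even, then the generalized Petersen graph $GP(n,3)$ has a perfect 2-coloring with the matrix $A_3$. If $n$ is odd, then $GP(n,3)$ has no perfect 2-coloring with the matrix $A_3$.
   Context: For integers $n \geq 3$ and $1 \leq k < n/2$, the generalized Petersen graph $GP(n,k)$ is the cubic graph with vertex set $\{a_i, b_i : 0 \leq i \leq n-1\}$ and edge set $\{a_i a_{i+1},\ a_i b_i,\ b_i b_{i+k} : 0 \leq i \leq n-1\}$, with indices taken modulo $n$. For a graph $G$ and an integer $m$, a mapping $T: V(G) \to \{1,\dots,m\}$ is called a perfect $m$-coloring with matrix $A = (a_{ij})_{i,j \in \{1,\dots,m\}}$ if $T$ is surjective and for all $i,j$, every vertex of color $i$ has exactly $a_{ij}$ neighbors of color $j$. (Perfect 2-colorings are considered up to renaming the two colors.) *)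

theory Defs
  imports "Graph_Theory.Digraph_Component" "Jordan_Normal_Form.Matrix"
begin

text \<open>
  Undirected simple graphs are represented, as usual in \<open>Graph_Theory\<close>, by symmetric pair
  digraphs: an edge \<open>uv\<close> is the pair of arcs \<open>(u, v)\<close>, \<open>(v, u)\<close>.
\<close>

datatype gp_vertex = av nat | bv nat

definition gen_petersen :: "nat \<Rightarrow> nat \<Rightarrow> gp_vertex pair_pre_digraph" where
  "gen_petersen n k = mk_symmetric
     \<lparr> pverts = av ` {0..<n} \<union> bv ` {0..<n},
       parcs = (\<Union>i\<in>{0..<n}. {(av i, av ((i + 1) mod n)), (av i, bv i), (bv i, bv ((i + k) mod n))}) \<rparr>"

lemma shift_mod_ne:
  fixes n i k :: nat
  assumes "0 < k" "k < n" "i < n"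
  shows "(i + k) mod n \<noteq> i"
proof (cases "i + k < n")
  case False
  then have "(i + k) mod n = i + k - n"
    using assms by (simp add: le_mod_geq)
  then show ?thesis using assms False by simp
qed (use assms in simp)

lemma pair_graph_gen_petersen:
  assumes "1 \<le> k" "2 * k < n"
  shows "pair_graph (gen_petersen n k)"
proof
  have ne: "\<And>i. i < n \<Longrightarrow> Suc i mod n \<noteq> i" "\<And>i. i < n \<Longrightarrow> (i + k) mod n \<noteq> i"
    using shift_mod_ne[of 1 n] shift_mod_ne[of k n] assms by auto
  show "finite (pverts (gen_petersen n k))" "finite (parcs (gen_petersen n k))"
    by (auto simp: gen_petersen_def mk_symmetric_def)
  show "symmetric (with_proj (gen_petersen n k))"
    by (auto simp: gen_petersen_def mk_symmetric_def symmetric_def arcs_ends_conv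
        intro!: symI)
  fix e assume e: "e \<in> parcs (gen_petersen n k)"
  then show "fst e \<in> pverts (gen_petersen n k)" "snd e \<in> pverts (gen_petersen n k)"
    using assms by (auto simp: gen_petersen_def mk_symmetric_def)
  show "fst e \<noteq> snd e"
    using e ne ne[symmetric] by (auto simp: gen_petersen_def mk_symmetric_def)
qed

text \<open>
  Colors are \<open>1, \<dots>, m\<close>, whereas rows and columns of \<open>A\<close> are counted from 0, so the paper's
  entry \<open>a\<^sub>i\<^sub>j\<close> is \<open>A $$ (i - 1, j - 1)\<close>.  Values of \<open>T\<close> outside the vertex set are irrelevant.
\<close>

definition perfect_coloring ::
    "'v pair_pre_digraph \<Rightarrow> nat \<Rightarrow> nat mat \<Rightarrow> ('v \<Rightarrow> nat) \<Rightarrow> bool" where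
  "perfect_coloring G m A T \<longleftrightarrow>
     A \<in> carrier_mat m m \<and>
     T ` pverts G = {1..m} \<and>
     (\<forall>i\<in>{1..m}. \<forall>j\<in>{1..m}. \<forall>v\<in>pverts G. T v = i \<longrightarrow>
        card {w \<in> pverts G. (v, w) \<in> parcs G \<and> T w = j} = A $$ (i - 1, j - 1))"

definition A\<^sub>3 :: "nat mat" where
  "A\<^sub>3 = mat_of_rows_list 2 [[1, 2], [2, 1]]"

end

theory Submission
  imports Defs
begin

text \<open>
  Replace the colors 1 and 2 by the signs \<open>1\<close> and \<open>-1\<close>. In a cubic graph, having one neighbor of
  the own color and two of the other one means that the signs of the neighbors add up to minus the
  sign of the vertex. Write \<open>x i\<close> and \<open>y i\<close> for the signs of \<open>a\<^sub>i\<close> and \<open>b\<^sub>i\<close>, with indices modulo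
  \<open>n\<close>; then a perfect coloring of \<open>GP(n,k)\<close> is a solution in signs of the linear system
  \<open>x (i-1) + x i + x (i+1) + y i = 0\<close> and \<open>y (i-k) + y i + y (i+k) + x i = 0\<close>.

  For even \<open>n\<close> and odd \<open>k\<close>, the alternating signs \<open>x i = y i = (-1)^i\<close> solve it.

  Let \<open>k = 3\<close> and \<open>n\<close> be odd. Eliminating \<open>y\<close> makes the three windows of length 3 fit together
  into one window of length 9: \<open>x (i-4) + \<dots> + x (i+4) = x i\<close>. Subtracting two consecutive
  windows shows that \<open>w i = x (i+4) - x i\<close> satisfies \<open>w (i+5) = - w i\<close>. After \<open>n\<close> such steps the
  sign has changed an odd number of times while the index has returned to itself modulo \<open>n\<close>, so
  \<open>w = 0\<close>. Thus \<open>x\<close> has the coprime periods \<open>4\<close> and \<open>n\<close> and is constant, and the first equation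
  gives \<open>y = -3 x\<close>, which is not a sign.
\<close>

definition nbhd :: "'v pair_pre_digraph \<Rightarrow> 'v \<Rightarrow> 'v set" where
  "nbhd G v = {w \<in> pverts G. (v, w) \<in> parcs G}"

definition color_sign :: "('v \<Rightarrow> nat) \<Rightarrow> 'v \<Rightarrow> int" where
  "color_sign T v = 3 - 2 * int (T v)"

section \<open>Perfect colorings of cubic graphs as sign equations\<close>

text \<open>
  The degree is known to be 3, so the numbers of neighbors of color 1 and of color 2 are determined
  by their difference, which is the sum of the signs.
\<close>

lemma perfect_coloring_A\<^sub>3_iff_sum_signs:
  assumes cubic: "\<And>v. v \<in> pverts G \<Longrightarrow> card (nbhd G v) = 3"
  shows "perfect_coloring G 2 A\<^sub>3 T \<longleftrightarrow>
    T ` pverts G = {1, 2} \<and>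
    (\<forall>v\<in>pverts G. (\<Sum>w\<in>nbhd G v. color_sign T w) = - color_sign T v)"
proof -
  have upto2: "{1..2} = {1, 2::nat}" by auto
  show ?thesis
  proof (cases "T ` pverts G = {1, 2}")
    case True
    have colors: "T w = 1 \<or> T w = 2" if "w \<in> pverts G" for w
      using True that by blast
    have entries: "A\<^sub>3 $$ (0, 0) = 1" "A\<^sub>3 $$ (0, Suc 0) = 2"
      "A\<^sub>3 $$ (Suc 0, 0) = 2" "A\<^sub>3 $$ (Suc 0, Suc 0) = 1" "A\<^sub>3 \<in> carrier_mat 2 2"
      by (auto simp: A\<^sub>3_def mat_of_rows_list_def)
    let ?c = "\<lambda>v j. card {w \<in> pverts G. (v, w) \<in> parcs G \<and> T w = j}"
    have local_iff: "(\<forall>i\<in>{1, 2}. \<forall>j\<in>{1, 2}. T v = i \<longrightarrow> ?c v j = A\<^sub>3 $$ (i - 1, j - 1)) \<longleftrightarrow>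
        (\<Sum>w\<in>nbhd G v. color_sign T w) = - color_sign T v" if v: "v \<in> pverts G" for v
    proof -
      have fin: "finite (nbhd G v)"
        using cubic[OF v] by (intro card_ge_0_finite) simp
      have c: "?c v j = card {w \<in> nbhd G v. T w = j}" for j
        by (rule arg_cong[of _ _ card]) (auto simp: nbhd_def)
      have split: "nbhd G v = {w \<in> nbhd G v. T w = 1} \<union> {w \<in> nbhd G v. T w = 2}"
        using colors by (auto simp: nbhd_def)
      have total: "?c v 1 + ?c v 2 = 3"
        unfolding c cubic[OF v, symmetric]
        by (subst (3) split, rule card_Un_disjoint[symmetric]) (use fin in auto)
      have "(\<Sum>w\<in>nbhd G v. color_sign T w) =
          (\<Sum>w\<in>{w \<in> nbhd G v. T w = 1}. color_sign T w) + (\<Sum>w\<in>{w \<in> nbhd G v. T w = 2}. color_sign T w)"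
        by (subst split, rule sum.union_disjoint) (use fin in auto)
      also have "\<dots> = int (?c v 1) - int (?c v 2)"
        unfolding c by (simp add: color_sign_def)
      finally have diff: "(\<Sum>w\<in>nbhd G v. color_sign T w) = int (?c v 1) - int (?c v 2)" .
      show ?thesis
        unfolding diff using colors[OF v] total
        by (elim disjE) (auto simp: color_sign_def entries)
    qed
    have swap: "(\<forall>i\<in>I. \<forall>j\<in>I. \<forall>v\<in>V. P i j v) \<longleftrightarrow> (\<forall>v\<in>V. \<forall>i\<in>I. \<forall>j\<in>I. P i j v)"
      for I :: "nat set" and V :: "'a set" and P
      by blast
    have "(\<forall>v\<in>pverts G. \<forall>i\<in>{1, 2}. \<forall>j\<in>{1, 2}. T v = i \<longrightarrow> ?c v j = A\<^sub>3 $$ (i - 1, j - 1)) \<longleftrightarrow>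
        (\<forall>v\<in>pverts G. (\<Sum>w\<in>nbhd G v. color_sign T w) = - color_sign T v)"
      by (intro ball_cong refl local_iff)
    then show ?thesis
      unfolding perfect_coloring_def upto2 swap by (simp only: True entries(5) simp_thms)
  next
    case False
    then show ?thesis
      unfolding perfect_coloring_def upto2 by blast
  qed
qed

section \<open>Neighborhoods in generalized Petersen graphs\<close>

lemma add_mod_cancel_iff:
  fixes i j k n :: nat
  shows "(j + k) mod n = (i + k) mod n \<longleftrightarrow> j mod n = i mod n"
proof -
  have "int ((j + k) mod n) = int ((i + k) mod n) \<longleftrightarrow> int (j mod n) = int (i mod n)"
    by (simp add: zmod_int mod_eq_dvd_iff)
  then show ?thesis by simp
qed

lemma add_mod_ne:
  fixes i k n :: nat
  assumes "0 < k" "k < n"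
  shows "(i + k) mod n \<noteq> i mod n"
  using shift_mod_ne[of k n "i mod n"] assms by (simp add: mod_simps)

text \<open>
  The vertex is given with index \<open>i + 1\<close> (respectively \<open>i + k\<close>), so that its two neighbors of
  its own kind have indices \<open>i\<close> and \<open>i + 2\<close> (respectively \<open>i\<close> and \<open>i + 2 k\<close>) and no subtraction modulo \<open>n\<close>
  occurs. All indices \<open>i\<close> are allowed, and every vertex arises in this way.
\<close>

lemma nbhd_av:
  assumes "0 < n"
  shows "nbhd (gen_petersen n k) (av ((i + 1) mod n)) =
    {av (i mod n), av ((i + 2) mod n), bv ((i + 1) mod n)}"
proof -
  have nbhd: "nbhd (gen_petersen n k) (av u) =
      insert (bv u) (av ` {j. j < n \<and> ((j + 1) mod n = u \<or> j = (u + 1) mod n)})" if "u < n" for u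
    using that by (auto simp: nbhd_def gen_petersen_def mk_symmetric_def)
  have "(j + 1) mod n = (i + 1) mod n \<longleftrightarrow> j = i mod n" if "j < n" for j
    using add_mod_cancel_iff[of j 1 n i] that by simp
  moreover have "((i + 1) mod n + 1) mod n = (i + 2) mod n"
    by (simp add: mod_simps)
  ultimately have "{j. j < n \<and> ((j + 1) mod n = (i + 1) mod n \<or> j = ((i + 1) mod n + 1) mod n)} =
      {i mod n, (i + 2) mod n}"
    using assms by auto
  then show ?thesis
    using nbhd[of "(i + 1) mod n"] assms by (simp add: insert_commute)
qed

lemma nbhd_bv:
  assumes "0 < n"
  shows "nbhd (gen_petersen n k) (bv ((i + k) mod n)) =
    {bv (i mod n), bv ((i + 2 * k) mod n), av ((i + k) mod n)}"
proof -
  have nbhd: "nbhd (gen_petersen n k) (bv u) =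
      insert (av u) (bv ` {j. j < n \<and> ((j + k) mod n = u \<or> j = (u + k) mod n)})" if "u < n" for u
    using that by (auto simp: nbhd_def gen_petersen_def mk_symmetric_def)
  have "(j + k) mod n = (i + k) mod n \<longleftrightarrow> j = i mod n" if "j < n" for j
    using add_mod_cancel_iff[of j k n i] that by simp
  moreover have "((i + k) mod n + k) mod n = (i + 2 * k) mod n"
    by (simp add: mod_simps mult_2 add.assoc)
  ultimately have "{j. j < n \<and> ((j + k) mod n = (i + k) mod n \<or> j = ((i + k) mod n + k) mod n)} =
      {i mod n, (i + 2 * k) mod n}"
    using assms by auto
  then show ?thesis
    using nbhd[of "(i + k) mod n"] assms by (simp add: insert_commute)
qed

lemma index_as_shift:
  fixes u k n :: nat
  assumes "u < n" "k \<le> n"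
  obtains i where "u = (i + k) mod n"
  using assms by (intro that[of "u + (n - k)"]) simp

lemma gen_petersen_vertex_cases:
  assumes "v \<in> pverts (gen_petersen n k)" "1 \<le> k" "2 * k < n"
  obtains i where "v = av ((i + 1) mod n)" | i where "v = bv ((i + k) mod n)"
proof -
  from assms(1) consider u where "u < n" "v = av u" | u where "u < n" "v = bv u"
    by (auto simp: gen_petersen_def mk_symmetric_def)
  then show thesis
  proof cases
    case 1
    then show ?thesis using index_as_shift[of u n 1] that(1) by auto
  next
    case 2
    then show ?thesis using index_as_shift[of u n k] assms(3) that(2) by auto
  qed
qed

lemma distinct_nbrs:
  fixes i k n :: nat
  assumes "1 \<le> k" "2 * k < n"
  shows "i mod n \<noteq> (i + 2) mod n" "i mod n \<noteq> (i + 2 * k) mod n"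
  using add_mod_ne[of 2 n i] add_mod_ne[of "2 * k" n i] assms by auto

lemma gen_petersen_cubic:
  assumes "v \<in> pverts (gen_petersen n k)" "1 \<le> k" "2 * k < n"
  shows "card (nbhd (gen_petersen n k) v) = 3"
proof -
  have "0 < n" using assms by simp
  show ?thesis
    using assms
    by (cases rule: gen_petersen_vertex_cases)
      (simp_all add: nbhd_av[OF \<open>0 < n\<close>, simplified] nbhd_bv[OF \<open>0 < n\<close>]
        distinct_nbrs[OF assms(2,3), simplified])
qed

lemma perfect_coloring_gen_petersen_iff:
  fixes n k :: nat and T :: "gp_vertex \<Rightarrow> nat"
  assumes "1 \<le> k" "2 * k < n"
  defines "x \<equiv> \<lambda>i. color_sign T (av (i mod n))" and "y \<equiv> \<lambda>i. color_sign T (bv (i mod n))"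
  shows "perfect_coloring (gen_petersen n k) 2 A\<^sub>3 T \<longleftrightarrow>
    T ` pverts (gen_petersen n k) = {1, 2} \<and>
    (\<forall>i. x i + x (i + 1) + x (i + 2) + y (i + 1) = 0) \<and>
    (\<forall>i. y i + y (i + k) + y (i + 2 * k) + x (i + k) = 0)"
proof -
  let ?G = "gen_petersen n k"
  have "0 < n" using assms by simp
  have av_in: "av (i mod n) \<in> pverts ?G" and bv_in: "bv (i mod n) \<in> pverts ?G" for i
    using \<open>0 < n\<close> by (auto simp: gen_petersen_def mk_symmetric_def)
  have sum_av: "(\<Sum>w\<in>nbhd ?G (av ((i + 1) mod n)). color_sign T w) = x i + x (i + 2) + y (i + 1)" for i
    unfolding nbhd_av[OF \<open>0 < n\<close>] x_def y_def
    using distinct_nbrs(1)[OF assms(1,2), of i] by simp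
  have sum_bv: "(\<Sum>w\<in>nbhd ?G (bv ((i + k) mod n)). color_sign T w) = y i + y (i + 2 * k) + x (i + k)" for i
    unfolding nbhd_bv[OF \<open>0 < n\<close>] x_def y_def
    using distinct_nbrs(2)[OF assms(1,2), of i] by simp
  have "(\<forall>v\<in>pverts ?G. (\<Sum>w\<in>nbhd ?G v. color_sign T w) = - color_sign T v) \<longleftrightarrow>
    (\<forall>i. x i + x (i + 2) + y (i + 1) = - x (i + 1)) \<and>
    (\<forall>i. y i + y (i + 2 * k) + x (i + k) = - y (i + k))" (is "?L \<longleftrightarrow> ?R")
  proof
    assume ?L
    then show ?R
      using av_in bv_in sum_av sum_bv unfolding x_def y_def by metis
  next
    assume R: ?R
    show ?L
    proof
      fix v assume "v \<in> pverts ?G"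
      then show "(\<Sum>w\<in>nbhd ?G v. color_sign T w) = - color_sign T v"
      proof (cases rule: gen_petersen_vertex_cases[OF _ assms(1,2), consumes 1, case_names outer inner])
        case (outer i)
        with R sum_av[of i] show ?thesis by (simp add: x_def)
      next
        case (inner i)
        with R sum_bv[of i] show ?thesis by (simp add: y_def)
      qed
    qed
  qed
  also have "?R \<longleftrightarrow> (\<forall>i. x i + x (i + 1) + x (i + 2) + y (i + 1) = 0) \<and>
    (\<forall>i. y i + y (i + k) + y (i + 2 * k) + x (i + k) = 0)"
    by (intro arg_cong2[of _ _ _ _ "(\<and>)"] arg_cong[of _ _ All] ext) linarith+
  finally have signs: "?L \<longleftrightarrow> (\<forall>i. x i + x (i + 1) + x (i + 2) + y (i + 1) = 0) \<and>
    (\<forall>i. y i + y (i + k) + y (i + 2 * k) + x (i + k) = 0)" .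
  have "perfect_coloring ?G 2 A\<^sub>3 T \<longleftrightarrow> T ` pverts ?G = {1, 2} \<and> ?L"
    by (rule perfect_coloring_A\<^sub>3_iff_sum_signs) (rule gen_petersen_cubic[OF _ assms(1,2)])
  then show ?thesis
    unfolding signs .
qed

section \<open>The alternating coloring\<close>

lemma alternating_perfect_coloring:
  assumes "1 \<le> k" "2 * k < n" "even n" "odd k"
  shows "perfect_coloring (gen_petersen n k) 2 A\<^sub>3
    (case_gp_vertex (\<lambda>i. 1 + i mod 2) (\<lambda>i. 1 + i mod 2))" (is "perfect_coloring _ _ _ ?T")
proof -
  have sign: "color_sign ?T (av (i mod n)) = (if even i then 1 else - 1)"
    "color_sign ?T (bv (i mod n)) = (if even i then 1 else - 1)" for i
    using assms(3) by (simp_all add: color_sign_def mod_mod_cancel odd_iff_mod_2_eq_one)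
  have "?T ` pverts (gen_petersen n k) = {1, 2}"
  proof
    show "?T ` pverts (gen_petersen n k) \<subseteq> {1, 2}"
      by (auto simp: gen_petersen_def mk_symmetric_def)
    have "av 0 \<in> pverts (gen_petersen n k)" "av 1 \<in> pverts (gen_petersen n k)"
      using assms by (auto simp: gen_petersen_def mk_symmetric_def)
    from this[THEN imageI[of _ _ ?T]] show "{1, 2} \<subseteq> ?T ` pverts (gen_petersen n k)"
      by (simp add: numeral_2_eq_2)
  qed
  then show ?thesis
    using assms unfolding perfect_coloring_gen_petersen_iff[OF assms(1,2)] sign by simp
qed

section \<open>Rigidity of the sign equations for odd cycles\<close>

lemma add_mult_period:
  fixes f :: "nat \<Rightarrow> 'a" and i m p :: nat
  assumes "\<And>i. f (i + p) = f i"
  shows "f (i + m * p) = f i"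
proof (induction m)
  case (Suc m)
  then show ?case using assms[of "i + m * p"] by (simp add: algebra_simps)
qed simp

lemma antiperiodic_add_mult:
  fixes w :: "nat \<Rightarrow> int" and i m p :: nat
  assumes "\<And>i. w (i + p) = - w i"
  shows "w (i + m * p) = (- 1) ^ m * w i"
proof (induction m)
  case (Suc m)
  then show ?case using assms[of "i + m * p"] by (simp add: algebra_simps)
qed simp

text \<open>
  Eliminating \<open>y\<close> gives \<open>w i = x (i + 4) - x i\<close> the antiperiod \<open>5\<close>, hence the antiperiod
  \<open>5 n\<close>, as \<open>n\<close> is odd. But \<open>5 n\<close> is also a period of \<open>w\<close>, so \<open>w\<close> vanishes, and \<open>x\<close> has
  the coprime periods \<open>4\<close> and \<open>n\<close>.
\<close>

lemma odd_period_constant: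
  fixes x y :: "nat \<Rightarrow> int"
  assumes "odd n" and period: "\<And>i. x (i + n) = x i"
    and outer: "\<And>i. x i + x (i + 1) + x (i + 2) + y (i + 1) = 0"
    and inner: "\<And>i. y i + y (i + 3) + y (i + 6) + x (i + 3) = 0"
  shows "x (i + 1) = x i"
proof -
  define w where "w i = x (i + 4) - x i" for i
  \<comment> \<open>The outer equations at \<open>i\<close>, \<open>i + 3\<close> and \<open>i + 6\<close> cover nine consecutive values of \<open>x\<close>; the
    inner equation replaces their three values of \<open>y\<close> by the middle one, \<open>x (i + 4)\<close>, which
    cancels.\<close>
  have window: "x i + x (i + 1) + x (i + 2) + x (i + 3) + x (i + 5) + x (i + 6) + x (i + 7)
    + x (i + 8) = 0" for i
    using outer[of i] outer[of "i + 3"] outer[of "i + 6"] inner[of "i + 1"]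
    by (simp add: numeral_eq_Suc)
  have "w (i + 5) = - w i" for i
    using window[of i] window[of "i + 1"] by (simp add: w_def numeral_eq_Suc)
  then have "w (i + n * 5) = - w i" for i
    using antiperiodic_add_mult[of w 5 i n] \<open>odd n\<close> by simp
  moreover have "w (i + 5 * n) = w i" for i
    by (rule add_mult_period) (use period[of "_ + 4"] period in
      \<open>simp add: w_def add.assoc add.commute[of n]\<close>)
  ultimately have "w i = 0" for i
    by (metis mult.commute equal_neg_zero)
  then have period4: "x (i + 4) = x i" for i
    by (simp add: w_def)
  \<comment> \<open>An odd square is \<open>1\<close> modulo \<open>4\<close>, so \<open>n\<close> steps of length \<open>n\<close> amount to a single step of
    length \<open>1\<close>.\<close>
  obtain m where m: "n = 2 * m + 1"
    using \<open>odd n\<close> by (elim oddE)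
  have "x (i + 1) = x (i + 1 + (m * m + m) * 4)"
    by (rule add_mult_period[symmetric]) (rule period4)
  also have "i + 1 + (m * m + m) * 4 = i + n * n"
    by (simp add: m algebra_simps)
  also have "x (i + n * n) = x i"
    by (rule add_mult_period) (rule period)
  finally show ?thesis .
qed

theorem theorem3p3:
  fixes n :: nat
  assumes "n \<ge> 7"
  shows "(even n \<longrightarrow> (\<exists>T. perfect_coloring (gen_petersen n 3) 2 A\<^sub>3 T)) \<and>
         (odd n \<longrightarrow> \<not> (\<exists>T. perfect_coloring (gen_petersen n 3) 2 A\<^sub>3 T))"
proof (intro conjI impI notI)
  assume "even n"
  with assms show "\<exists>T. perfect_coloring (gen_petersen n 3) 2 A\<^sub>3 T"
    using alternating_perfect_coloring[of 3 n] by auto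
next
  assume "odd n" and "\<exists>T. perfect_coloring (gen_petersen n 3) 2 A\<^sub>3 T"
  then obtain T where T: "perfect_coloring (gen_petersen n 3) 2 A\<^sub>3 T" by blast
  define x where "x i = color_sign T (av (i mod n))" for i
  define y where "y i = color_sign T (bv (i mod n))" for i
  have colors: "T ` pverts (gen_petersen n 3) = {1, 2}"
    and outer: "\<And>i. x i + x (i + 1) + x (i + 2) + y (i + 1) = 0"
    and inner: "\<And>i. y i + y (i + 3) + y (i + 6) + x (i + 3) = 0"
    using T perfect_coloring_gen_petersen_iff[of 3 n T] assms by (simp_all add: x_def y_def)
  have "x (i + 1) = x i" for i
    by (rule odd_period_constant[OF \<open>odd n\<close> _ outer inner]) (simp add: x_def)
  from this[of 0] this[of 1] outer[of 0] have "y 1 = - 3 * x 0"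
    by (simp add: numeral_2_eq_2)
  moreover have "av (0 mod n) \<in> pverts (gen_petersen n 3)" "bv (1 mod n) \<in> pverts (gen_petersen n 3)"
    using assms by (auto simp: gen_petersen_def mk_symmetric_def)
  then have "T (av (0 mod n)) \<in> {1, 2}" "T (bv (1 mod n)) \<in> {1, 2}"
    unfolding colors[symmetric] by simp_all
  then have "x 0 \<in> {1, - 1}" "y 1 \<in> {1, - 1}"
    by (auto simp: x_def y_def color_sign_def)
  ultimately show False
    by (elim insertE emptyE) simp_all
qed

end
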